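(* Let $K$ be a field of characteristic $0$, let $X=\{x_1,x_2,\ldots\}$ be a countable set, and let $\mathrm{NAP}(X)$ be the free nonassociative permutative algebra over $K$ generated by $X$. Let $\mathrm{NAP}^{(-)}(X)$ be the algebra $\mathrm{NAP}(X)$ considered under the commutator $[a,b]=ab-ba$. Then every identity (in the operation $[\cdot,\cdot]$) of the algebra $\mathrm{NAP}^{(-)}(X)$ is a consequence of the anti-commutative identity $[a,b]=-[b,a]$.
   Context: A nonassociative permutative (NAP) algebra is a (not necessarily associative, not necessarily unital) $K$-algebra satisfying the right-commutative identity $(ab)c=(ac)b$. An identity is a consequence of a set of identities if it holds in every $K$-algebra (with one bilinear operation) satisfying that set of identities. *)

theory Defs
  imports Complex_Main "HOL-Library.Poly_Mapping"
begin

locale nonassoc_algebra = vector_space scale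
  for scale :: "'k::field \<Rightarrow> 'a::ab_group_add \<Rightarrow> 'a" +
  fixes mult :: "'a \<Rightarrow> 'a \<Rightarrow> 'a"
  assumes mult_add_left: "mult (a + b) c = mult a c + mult b c"
    and mult_add_right: "mult a (b + c) = mult a b + mult a c"
    and mult_scale_left: "mult (scale r a) b = scale r (mult a b)"
    and mult_scale_right: "mult a (scale r b) = scale r (mult a b)"

locale nap_algebra = nonassoc_algebra +
  assumes right_commute: "mult (mult a b) c = mult (mult a c) b"

definition commutator :: "('a::ab_group_add \<Rightarrow> 'a \<Rightarrow> 'a) \<Rightarrow> 'a \<Rightarrow> 'a \<Rightarrow> 'a"
  where "commutator mult a b = mult a b - mult b a"


subsection \<open>Nonassociative polynomials\<close>

datatype 'x magma = Var 'x | Mul "'x magma" "'x magma"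

text \<open>Finitely supported functions on the free magma: the free nonassociative (non-unital)
  algebra. Its elements also serve as the formal expressions of identities.\<close>

type_synonym ('x, 'k) npoly = "'x magma \<Rightarrow>\<^sub>0 'k"

lift_definition npoly_scale :: "'k::field \<Rightarrow> ('x, 'k) npoly \<Rightarrow> ('x, 'k) npoly"
  is "\<lambda>r p t. r * p t"
  by (rule finite_subset) auto

text \<open>The bilinear extension of the magma product; every compound word factors uniquely.\<close>

lift_definition npoly_mult :: "('x, 'k::field) npoly \<Rightarrow> ('x, 'k) npoly \<Rightarrow> ('x, 'k) npoly"
  is "\<lambda>p q t. case t of Var x \<Rightarrow> 0 | Mul u v \<Rightarrow> p u * q v"
proof -
  fix p q :: "'x magma \<Rightarrow> 'k"
  assume fin: "finite {t. p t \<noteq> 0}" "finite {t. q t \<noteq> 0}"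
  have "{t. (case t of Var x \<Rightarrow> 0 | Mul u v \<Rightarrow> p u * q v) \<noteq> 0}
      \<subseteq> (\<lambda>(u, v). Mul u v) ` ({t. p t \<noteq> 0} \<times> {t. q t \<noteq> 0})"
    by (auto simp: image_iff split: magma.split_asm)
  then show "finite {t. (case t of Var x \<Rightarrow> 0 | Mul u v \<Rightarrow> p u * q v) \<noteq> 0}"
    by (rule finite_subset) (use fin in auto)
qed

interpretation npoly: nonassoc_algebra
  "npoly_scale :: 'k::field \<Rightarrow> ('x, 'k) npoly \<Rightarrow> ('x, 'k) npoly" npoly_mult
proof
  fix r s :: 'k and p q w :: "('x, 'k) npoly"
  show "npoly_scale r (p + q) = npoly_scale r p + npoly_scale r q"
    "npoly_scale (r + s) p = npoly_scale r p + npoly_scale s p"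
    "npoly_scale r (npoly_scale s p) = npoly_scale (r * s) p"
    "npoly_scale 1 p = p"
    by (transfer, simp add: algebra_simps)+
  show "npoly_mult (p + q) w = npoly_mult p w + npoly_mult q w"
    "npoly_mult p (q + w) = npoly_mult p q + npoly_mult p w"
    "npoly_mult (npoly_scale r p) q = npoly_scale r (npoly_mult p q)"
    "npoly_mult p (npoly_scale r q) = npoly_scale r (npoly_mult p q)"
    by (transfer, auto simp: algebra_simps fun_eq_iff split: magma.splits)+
qed

definition npoly_var :: "'x \<Rightarrow> ('x, 'k::field) npoly"
  where "npoly_var x = Poly_Mapping.single (Var x) 1"

primrec eval_magma :: "('a \<Rightarrow> 'a \<Rightarrow> 'a) \<Rightarrow> ('x \<Rightarrow> 'a) \<Rightarrow> 'x magma \<Rightarrow> 'a" where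
  "eval_magma mult v (Var x) = v x"
| "eval_magma mult v (Mul s t) = mult (eval_magma mult v s) (eval_magma mult v t)"

definition eval_npoly ::
  "('k::field \<Rightarrow> 'a::ab_group_add \<Rightarrow> 'a) \<Rightarrow> ('a \<Rightarrow> 'a \<Rightarrow> 'a) \<Rightarrow> ('x \<Rightarrow> 'a) \<Rightarrow> ('x, 'k) npoly \<Rightarrow> 'a"
  where "eval_npoly scale mult v p =
    (\<Sum>t\<in>Poly_Mapping.keys p. scale (Poly_Mapping.lookup p t) (eval_magma mult v t))"


subsection \<open>Identities and their consequences\<close>

definition is_identity ::
  "('k::field \<Rightarrow> 'a::ab_group_add \<Rightarrow> 'a) \<Rightarrow> ('a \<Rightarrow> 'a \<Rightarrow> 'a) \<Rightarrow> (nat, 'k) npoly \<Rightarrow> bool"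
  where "is_identity scale mult p \<longleftrightarrow> (\<forall>v. eval_npoly scale mult v p = 0)"

text \<open>A definition cannot quantify over types, so this speaks of all algebra structures on one
  type \<open>'a\<close>. Consequence in the full sense is obtained by leaving \<open>'a\<close> arbitrary in a theorem.\<close>

definition is_consequence ::
  "'a::ab_group_add itself \<Rightarrow> (nat, 'k::field) npoly set \<Rightarrow> (nat, 'k) npoly \<Rightarrow> bool"
  where "is_consequence _ S p \<longleftrightarrow>
    (\<forall>(scale :: 'k \<Rightarrow> 'a \<Rightarrow> 'a) mult. nonassoc_algebra scale mult \<longrightarrow>
      (\<forall>q\<in>S. is_identity scale mult q) \<longrightarrow> is_identity scale mult p)"

text \<open>The identity \<open>x\<^sub>0 x\<^sub>1 = - x\<^sub>1 x\<^sub>0\<close>, with all terms moved to one side.\<close>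

definition anticomm_identity :: "(nat, 'k::field) npoly"
  where "anticomm_identity =
    npoly_mult (npoly_var 0) (npoly_var 1) + npoly_mult (npoly_var 1) (npoly_var 0)"


subsection \<open>The free nonassociative permutative algebra\<close>

text \<open>The two-sided ideal generated by all values of \<open>(a b) c - (a c) b\<close>.\<close>

inductive_set nap_ideal :: "('x, 'k::field) npoly set" where
  gen: "npoly_mult (npoly_mult a b) c - npoly_mult (npoly_mult a c) b \<in> nap_ideal"
| zero: "0 \<in> nap_ideal"
| add: "p \<in> nap_ideal \<Longrightarrow> q \<in> nap_ideal \<Longrightarrow> p + q \<in> nap_ideal"
| scale: "p \<in> nap_ideal \<Longrightarrow> npoly_scale r p \<in> nap_ideal"
| mult_left: "p \<in> nap_ideal \<Longrightarrow> npoly_mult a p \<in> nap_ideal"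
| mult_right: "p \<in> nap_ideal \<Longrightarrow> npoly_mult p a \<in> nap_ideal"

lemma nap_ideal_uminus: "p \<in> nap_ideal \<Longrightarrow> - p \<in> nap_ideal"
  using nap_ideal.scale[of p "- 1"] by simp

definition nap_cong :: "('x, 'k::field) npoly \<Rightarrow> ('x, 'k) npoly \<Rightarrow> bool"
  where "nap_cong p q \<longleftrightarrow> p - q \<in> nap_ideal"

lemma equivp_nap_cong: "equivp nap_cong"
proof (rule equivpI)
  show "reflp nap_cong"
    by (auto simp: reflp_def nap_cong_def nap_ideal.zero)
  show "symp nap_cong"
    by (auto simp: symp_def nap_cong_def dest: nap_ideal_uminus)
  show "transp nap_cong"
    by (auto simp: transp_def nap_cong_def dest: nap_ideal.add)
qed

quotient_type (overloaded) ('x, 'k) nap = "('x, 'k::field) npoly" / nap_cong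
  by (rule equivp_nap_cong)

instantiation nap :: (type, field) ab_group_add
begin

lift_definition zero_nap :: "('a, 'b) nap" is 0 .

lift_definition plus_nap :: "('a, 'b) nap \<Rightarrow> ('a, 'b) nap \<Rightarrow> ('a, 'b) nap" is "(+)"
  by (auto simp: nap_cong_def add_diff_add intro: nap_ideal.add)

lift_definition uminus_nap :: "('a, 'b) nap \<Rightarrow> ('a, 'b) nap" is uminus
  by (auto simp: nap_cong_def dest: nap_ideal_uminus)

lift_definition minus_nap :: "('a, 'b) nap \<Rightarrow> ('a, 'b) nap \<Rightarrow> ('a, 'b) nap" is "(-)"
proof -
  fix p p' q q' :: "('a, 'b) npoly"
  assume "nap_cong p p'" "nap_cong q q'"
  then have "(p - p') + - (q - q') \<in> nap_ideal"
    unfolding nap_cong_def by (intro nap_ideal.add nap_ideal_uminus)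
  then show "nap_cong (p - q) (p' - q')"
    by (simp add: nap_cong_def algebra_simps)
qed

instance
  by standard (transfer, simp add: nap_cong_def algebra_simps nap_ideal.zero)+

end

lift_definition nap_scale :: "'k::field \<Rightarrow> ('x, 'k) nap \<Rightarrow> ('x, 'k) nap" is npoly_scale
  by (auto simp: nap_cong_def npoly.scale_right_diff_distrib[symmetric] intro: nap_ideal.scale)

lift_definition nap_mult :: "('x, 'k::field) nap \<Rightarrow> ('x, 'k) nap \<Rightarrow> ('x, 'k) nap" is npoly_mult
proof -
  fix p p' q q' :: "('x, 'k) npoly"
  assume "nap_cong p p'" "nap_cong q q'"
  then have mem: "npoly_mult (p - p') q + npoly_mult p' (q - q') \<in> nap_ideal"
    unfolding nap_cong_def by (intro nap_ideal.add nap_ideal.mult_left nap_ideal.mult_right)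
  have "npoly_mult (p - p') q = npoly_mult p q - npoly_mult p' q"
    using npoly.mult_add_left[of "p - p'" p' q] by (simp add: algebra_simps)
  moreover have "npoly_mult p' (q - q') = npoly_mult p' q - npoly_mult p' q'"
    using npoly.mult_add_right[of p' "q - q'" q'] by (simp add: algebra_simps)
  ultimately show "nap_cong (npoly_mult p q) (npoly_mult p' q')"
    using mem by (simp add: nap_cong_def)
qed

lift_definition nap_var :: "'x \<Rightarrow> ('x, 'k::field) nap" is npoly_var .

interpretation nap: nap_algebra
  "nap_scale :: 'k::field \<Rightarrow> ('x, 'k) nap \<Rightarrow> ('x, 'k) nap" nap_mult
proof
  fix r s :: 'k and a b c :: "('x, 'k) nap"
  have refl: "nap_cong p p" for p :: "('x, 'k) npoly"
    by (simp add: nap_cong_def nap_ideal.zero)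
  show "nap_scale r (a + b) = nap_scale r a + nap_scale r b"
    by transfer (simp add: npoly.scale_right_distrib refl)
  show "nap_scale (r + s) a = nap_scale r a + nap_scale s a"
    by transfer (simp add: npoly.scale_left_distrib refl)
  show "nap_scale r (nap_scale s a) = nap_scale (r * s) a"
    by transfer (simp add: refl)
  show "nap_scale 1 a = a"
    by transfer (simp add: refl)
  show "nap_mult (a + b) c = nap_mult a c + nap_mult b c"
    by transfer (simp add: npoly.mult_add_left refl)
  show "nap_mult a (b + c) = nap_mult a b + nap_mult a c"
    by transfer (simp add: npoly.mult_add_right refl)
  show "nap_mult (nap_scale r a) b = nap_scale r (nap_mult a b)"
    by transfer (simp add: npoly.mult_scale_left refl)
  show "nap_mult a (nap_scale r b) = nap_scale r (nap_mult a b)"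
    by transfer (simp add: npoly.mult_scale_right refl)
  show "nap_mult (nap_mult a b) c = nap_mult (nap_mult a c) b"
    by transfer (simp add: nap_cong_def nap_ideal.gen)
qed


subsection \<open>Universal property\<close>

context nonassoc_algebra
begin

lemma mult_0_left [simp]: "mult 0 a = 0"
  using mult_scale_left[of 0 0 a] by simp

lemma mult_0_right [simp]: "mult a 0 = 0"
  using mult_scale_right[of a 0 0] by simp

lemma mult_sum_left: "mult (sum f A) b = (\<Sum>i\<in>A. mult (f i) b)"
  by (induction A rule: infinite_finite_induct) (simp_all add: mult_add_left)

lemma mult_sum_right: "mult a (sum f A) = (\<Sum>i\<in>A. mult a (f i))"
  by (induction A rule: infinite_finite_induct) (simp_all add: mult_add_right)

lemma eval_npoly_superset:
  assumes "finite A" "Poly_Mapping.keys p \<subseteq> A"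
  shows "eval_npoly scale mult v p =
    (\<Sum>t\<in>A. scale (Poly_Mapping.lookup p t) (eval_magma mult v t))"
  unfolding eval_npoly_def using assms
  by (intro sum.mono_neutral_left) (auto simp: in_keys_iff)

lemma eval_npoly_0 [simp]: "eval_npoly scale mult v 0 = 0"
  by (simp add: eval_npoly_def)

lemma eval_npoly_add:
  "eval_npoly scale mult v (p + q) = eval_npoly scale mult v p + eval_npoly scale mult v q"
proof -
  let ?A = "Poly_Mapping.keys p \<union> Poly_Mapping.keys q"
  have "Poly_Mapping.keys (p + q) \<subseteq> ?A"
    by (rule Poly_Mapping.keys_add)
  then show ?thesis
    by (simp add: eval_npoly_superset[of ?A] lookup_add scale_left_distrib sum.distrib)
qed

lemma eval_npoly_scale:
  "eval_npoly scale mult v (npoly_scale r p) = scale r (eval_npoly scale mult v p)"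
proof -
  have "Poly_Mapping.keys (npoly_scale r p) \<subseteq> Poly_Mapping.keys p"
    by (auto simp: in_keys_iff npoly_scale.rep_eq)
  then show ?thesis
    by (simp add: eval_npoly_superset[of "Poly_Mapping.keys p"] npoly_scale.rep_eq scale_sum_right)
qed

lemma eval_npoly_diff:
  "eval_npoly scale mult v (p - q) = eval_npoly scale mult v p - eval_npoly scale mult v q"
  using eval_npoly_add[of v "p - q" q] by simp

lemma eval_npoly_mult:
  "eval_npoly scale mult v (npoly_mult p q) =
    mult (eval_npoly scale mult v p) (eval_npoly scale mult v q)"
proof -
  let ?P = "Poly_Mapping.keys p" and ?Q = "Poly_Mapping.keys q"
  let ?M = "\<lambda>(s, t). Mul s t"
  have sub: "Poly_Mapping.keys (npoly_mult p q) \<subseteq> ?M ` (?P \<times> ?Q)"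
    by (auto simp: in_keys_iff npoly_mult.rep_eq image_iff split: magma.splits)
  have inj: "inj_on ?M (?P \<times> ?Q)"
    by (auto simp: inj_on_def)
  have "eval_npoly scale mult v (npoly_mult p q) = (\<Sum>(s, t)\<in>?P \<times> ?Q.
      scale (Poly_Mapping.lookup p s * Poly_Mapping.lookup q t)
        (mult (eval_magma mult v s) (eval_magma mult v t)))"
    by (subst eval_npoly_superset[OF _ sub])
      (auto simp: sum.reindex[OF inj] npoly_mult.rep_eq intro!: sum.cong)
  also have "\<dots> = mult (eval_npoly scale mult v p) (eval_npoly scale mult v q)"
    by (simp add: eval_npoly_def mult_sum_left mult_sum_right mult_scale_left mult_scale_right
        sum.cartesian_product[symmetric] scale_sum_right mult.commute
        sum.swap[of _ ?P ?Q])
  finally show ?thesis .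
qed

lemma eval_npoly_var: "eval_npoly scale mult v (npoly_var x) = v x"
  by (simp add: eval_npoly_def npoly_var_def)

lemma is_identity_anticomm:
  "is_identity scale mult anticomm_identity \<longleftrightarrow> (\<forall>a b. mult a b = - mult b a)"
proof -
  have "is_identity scale mult anticomm_identity \<longleftrightarrow>
      (\<forall>v :: nat \<Rightarrow> _. mult (v 0) (v 1) = - mult (v 1) (v 0))"
    by (simp add: is_identity_def anticomm_identity_def eval_npoly_add eval_npoly_mult
        eval_npoly_var eq_neg_iff_add_eq_0)
  also have "\<dots> \<longleftrightarrow> (\<forall>a b. mult a b = - mult b a)"
  proof (intro iffI allI)
    fix a b
    assume *: "\<forall>v :: nat \<Rightarrow> _. mult (v 0) (v 1) = - mult (v 1) (v 0)"
    show "mult a b = - mult b a"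
      using *[rule_format, of "\<lambda>i. if i = 0 then a else b"] by simp
  qed blast
  finally show ?thesis .
qed

lemma commutator_algebra: "nonassoc_algebra scale (commutator mult)"
  by unfold_locales
    (simp_all add: commutator_def mult_add_left mult_add_right mult_scale_left mult_scale_right
      scale_right_diff_distrib algebra_simps)

end

lemma npoly_induct [case_names var add scale mult]:
  fixes p :: "('x, 'k::field) npoly"
  assumes var: "\<And>x. P (npoly_var x)"
    and add: "\<And>p q. P p \<Longrightarrow> P q \<Longrightarrow> P (p + q)"
    and scale: "\<And>r p. P p \<Longrightarrow> P (npoly_scale r p)"
    and mult: "\<And>p q. P p \<Longrightarrow> P q \<Longrightarrow> P (npoly_mult p q)"
  shows "P p"
proof -
  have word: "P (Poly_Mapping.single t 1)" for t
  proof (induction t)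
    case (Var x)
    then show ?case using var[of x] by (simp add: npoly_var_def)
  next
    case (Mul s t)
    have "npoly_mult (Poly_Mapping.single s 1) (Poly_Mapping.single t 1) =
        (Poly_Mapping.single (Mul s t) 1 :: ('x, 'k) npoly)"
      by transfer (auto simp: fun_eq_iff when_def split: magma.splits)
    then show ?case using mult[OF Mul] by simp
  qed
  have single: "P (Poly_Mapping.single t r)" for t r
  proof -
    have "npoly_scale r (Poly_Mapping.single t 1) = Poly_Mapping.single t r"
      by transfer (auto simp: fun_eq_iff when_def)
    then show ?thesis using scale[OF word[of t], of r] by simp
  qed
  have zero: "P 0"
    using scale[OF var, of 0] by simp
  have "P (\<Sum>t\<in>A. Poly_Mapping.single t (Poly_Mapping.lookup p t))" if "finite A" for A
    using that by (induction A) (simp_all add: zero add single)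
  moreover have "(\<Sum>t\<in>Poly_Mapping.keys p. Poly_Mapping.single t (Poly_Mapping.lookup p t)) = p"
    by (rule poly_mapping_eqI)
      (auto simp: lookup_sum lookup_single when_def sum.delta in_keys_iff)
  ultimately show ?thesis
    by (metis finite_keys)
qed

theorem nap_universal:
  fixes scale :: "'k::field \<Rightarrow> 'a::ab_group_add \<Rightarrow> 'a"
  assumes "nap_algebra scale mult"
  shows "\<exists>!h. (\<forall>a b. h (a + b) = h a + h b) \<and> (\<forall>r a. h (nap_scale r a) = scale r (h a)) \<and>
    (\<forall>a b. h (nap_mult a b) = mult (h a) (h b)) \<and> (\<forall>x. h (nap_var x) = v x)"
proof -
  interpret nap_algebra scale mult by fact
  let ?e = "eval_npoly scale mult v"
  have ideal: "?e p = 0" if "p \<in> nap_ideal" for p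
    using that
    by induction (simp_all add: eval_npoly_add eval_npoly_diff eval_npoly_scale eval_npoly_mult
        right_commute)
  have resp: "?e p = ?e q" if "nap_cong p q" for p q
    using ideal[of "p - q"] that by (simp add: nap_cong_def eval_npoly_diff)
  define h where "h a = ?e (rep_nap a)" for a
  have h: "h (abs_nap p) = ?e p" for p
    unfolding h_def
    by (rule resp) (metis Quotient3_nap Quotient3_abs_rep nap.abs_eq_iff)
  show ?thesis
  proof (rule ex1I[of _ h], intro conjI allI)
    fix a b r x
    show "h (a + b) = h a + h b"
      by (induct a, induct b) (simp add: plus_nap.abs_eq h eval_npoly_add)
    show "h (nap_scale r a) = scale r (h a)"
      by (induct a) (simp add: nap_scale.abs_eq h eval_npoly_scale)
    show "h (nap_mult a b) = mult (h a) (h b)"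
      by (induct a, induct b) (simp add: nap_mult.abs_eq h eval_npoly_mult)
    show "h (nap_var x) = v x"
      by (simp add: nap_var.abs_eq h eval_npoly_var)
  next
    fix g
    assume g: "(\<forall>a b. g (a + b) = g a + g b) \<and> (\<forall>r a. g (nap_scale r a) = scale r (g a)) \<and>
      (\<forall>a b. g (nap_mult a b) = mult (g a) (g b)) \<and> (\<forall>x. g (nap_var x) = v x)"
    have "g (abs_nap p) = ?e p" for p
    proof (induction p rule: npoly_induct)
      case (var x)
      then show ?case using g by (simp add: nap_var.abs_eq[symmetric] eval_npoly_var)
    next
      case (add p q)
      then show ?case using g by (simp add: plus_nap.abs_eq[symmetric] eval_npoly_add)
    next
      case (scale r p)
      then show ?case using g by (simp add: nap_scale.abs_eq[symmetric] eval_npoly_scale)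
    next
      case (mult p q)
      then show ?case using g by (simp add: nap_mult.abs_eq[symmetric] eval_npoly_mult)
    qed
    then have "g a = h a" for a
      by (induct a) (simp add: h)
    then show "g = h" by blast
  qed
qed

end

theory Submission
  imports Defs "HOL-Library.Function_Algebras" "HOL-Library.Nat_Bijection"
begin

text \<open>
  In an anticommutative algebra over a field of characteristic 0 every word equals 0 or plus or
  minus a normal word, that is, a word in which the left factor of every product is larger than
  the right one. Hence an identity follows from anticommutativity as soon as the coefficients of
  its normal words, collected in \<open>normal_coeff\<close>, vanish. It remains to find one NAP algebra in
  whose commutator algebra the normal words take linearly independent values at some choice of the
  letters: identities of the commutator algebra of the free NAP algebra pass to the commutator
  algebra of every NAP algebra (\<open>nap_identity_transfer\<close>).

  Let \<open>C\<close> be a commutative algebra and \<open>\<phi>\<close> a linear map from \<open>C\<close> to itself. The product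
  \<open>p \<cdot> q = p \<phi>(q)\<close> is then NAP, since \<open>(p \<cdot> q) \<cdot> r = p \<phi>(q) \<phi>(r)\<close> is symmetric in \<open>q\<close> and \<open>r\<close>.
  Here \<open>C\<close> consists of functions of independent parameters \<open>\<sigma> x\<close>, one for each letter \<open>x\<close>, and
  \<open>\<rho> w\<close>, one for each word \<open>w\<close>, and the letter \<open>x\<close> is sent to \<open>\<sigma> x\<close>. If \<open>\<phi>\<close> sends the value of
  each normal word \<open>w\<close> to \<open>\<rho> w\<close>, then the values \<open>P\<close> of the normal words are given by
  \<open>P (s t) = P s \<cdot> \<rho> t - P t \<cdot> \<rho> s\<close>. This recursion does not mention \<open>\<phi>\<close>, so it defines \<open>P\<close>
  (\<open>path_sum\<close>) beforehand, and a linear \<open>\<phi>\<close> with the required values exists because the functions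
  \<open>P w\<close>, for \<open>w\<close> normal, are linearly independent.

  That independence (\<open>path_sum_independent\<close>) is the heart of the proof. In a linear relation, let
  \<open>a\<close> be the largest left factor that occurs in a normal word \<open>a b\<close> with nonzero coefficient.
  The function \<open>P w\<close> involves \<open>\<rho> u\<close> only for proper subwords \<open>u\<close> of \<open>w\<close>, and these are smaller
  than \<open>w\<close>. By the choice of \<open>a\<close>, the parameter \<open>\<rho> a\<close> therefore occurs only in the summands
  \<open>- P b \<cdot> \<rho> a\<close> that come from the words \<open>a b\<close>. Comparing coefficients of \<open>\<rho> a\<close> leaves a relation
  between the functions \<open>P b\<close>, which is trivial by induction.
\<close>

section \<open>Normal words\<close>

text \<open>An injective numbering of the words in which proper subwords come first; it serves as the
  total order on words.\<close>

primrec word_code :: "nat magma \<Rightarrow> nat" where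
  "word_code (Var x) = 2 * x"
| "word_code (Mul s t) = Suc (2 * prod_encode (word_code s, word_code t))"

lemma code_inject [simp]: "word_code s = word_code t \<longleftrightarrow> s = t"
proof (induction s arbitrary: t)
  case (Var x)
  show ?case by (cases t) (simp_all, presburger)
next
  case (Mul s1 s2)
  show ?case
  proof (cases t)
    case (Var y)
    then show ?thesis by simp presburger
  next
    case (Mul t1 t2)
    then show ?thesis using Mul.IH by simp
  qed
qed

lemma code_factor_less: "word_code s < word_code (Mul s t)" "word_code t < word_code (Mul s t)"
  using le_prod_encode_1[of "word_code s" "word_code t"] le_prod_encode_2[of "word_code t" "word_code s"] by simp_all

primrec normal :: "nat magma \<Rightarrow> bool" where
  "normal (Var x) = True"
| "normal (Mul s t) = (normal s \<and> normal t \<and> word_code t < word_code s)"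

text \<open>When the normal forms of both factors agree, the word vanishes in every anticommutative
  algebra. This is recorded by the sign 0, and the value of \<open>normal_form\<close> is an arbitrary normal
  word.\<close>

primrec normal_form :: "nat magma \<Rightarrow> nat magma" where
  "normal_form (Var x) = Var x"
| "normal_form (Mul s t) =
    (if word_code (normal_form t) < word_code (normal_form s) then Mul (normal_form s) (normal_form t)
     else if word_code (normal_form s) < word_code (normal_form t) then Mul (normal_form t) (normal_form s)
     else normal_form s)"

primrec normal_sign :: "nat magma \<Rightarrow> 'k::field" where
  "normal_sign (Var x) = 1"
| "normal_sign (Mul s t) =
    (if word_code (normal_form t) < word_code (normal_form s) then normal_sign s * normal_sign t
     else if word_code (normal_form s) < word_code (normal_form t) then - (normal_sign s * normal_sign t)
     else 0)"

lemma normal_normal_form: "normal (normal_form t)"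
  by (induction t) simp_all

locale anticommutative_algebra = nonassoc_algebra scale mult
  for scale :: "'k::field_char_0 \<Rightarrow> 'a::ab_group_add \<Rightarrow> 'a" and mult +
  assumes anticomm: "mult a b = - mult b a"
begin

lemma mult_self: "mult a a = 0"
proof -
  have "scale 2 (mult a a) = mult a a + mult a a"
    using scale_left_distrib[of 1 1 "mult a a"] by simp
  also have "\<dots> = 0"
    using anticomm[of a a] by (simp add: eq_neg_iff_add_eq_0)
  finally show ?thesis by simp
qed

lemma eval_magma_normal_form:
  "eval_magma mult v t = scale (normal_sign t) (eval_magma mult v (normal_form t))"
proof (induction t)
  case (Var x)
  show ?case by simp
next
  case (Mul s t)
  let ?s = "eval_magma mult v (normal_form s)" and ?t = "eval_magma mult v (normal_form t)"
  have *: "eval_magma mult v (Mul s t) = scale (normal_sign s * normal_sign t) (mult ?s ?t)"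
    unfolding eval_magma.simps Mul.IH by (simp add: mult_scale_left mult_scale_right)
  consider "word_code (normal_form t) < word_code (normal_form s)"
    | "word_code (normal_form s) < word_code (normal_form t)" | "normal_form s = normal_form t"
    by (metis code_inject linorder_neqE_nat)
  then show ?case
  proof cases
    case 1
    then show ?thesis unfolding * by simp
  next
    case 2
    then show ?thesis unfolding * anticomm[of ?s ?t] by simp
  next
    case 3
    then show ?thesis unfolding * by (simp add: mult_self)
  qed
qed

end

definition normal_coeff :: "(nat, 'k::field) npoly \<Rightarrow> nat magma \<Rightarrow> 'k" where
  "normal_coeff f w =
    (\<Sum>t | t \<in> Poly_Mapping.keys f \<and> normal_form t = w. Poly_Mapping.lookup f t * normal_sign t)"

text \<open>Grouping the words of \<open>f\<close> by their normal forms: in an anticommutative algebra the values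
  of \<open>f\<close> depend only on the coefficients \<open>normal_coeff f\<close>.\<close>

lemma (in anticommutative_algebra) eval_npoly_normal_coeff:
  "eval_npoly scale mult v f =
    (\<Sum>w\<in>normal_form ` Poly_Mapping.keys f. scale (normal_coeff f w) (eval_magma mult v w))"
proof -
  have "eval_npoly scale mult v f = (\<Sum>t\<in>Poly_Mapping.keys f.
      scale (Poly_Mapping.lookup f t * normal_sign t) (eval_magma mult v (normal_form t)))"
    unfolding eval_npoly_def by (subst eval_magma_normal_form) simp
  also have "\<dots> = (\<Sum>w\<in>normal_form ` Poly_Mapping.keys f.
      \<Sum>t | t \<in> Poly_Mapping.keys f \<and> normal_form t = w.
        scale (Poly_Mapping.lookup f t * normal_sign t) (eval_magma mult v (normal_form t)))"
    by (rule sum.image_gen) simp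
  also have "\<dots> = (\<Sum>w\<in>normal_form ` Poly_Mapping.keys f.
      scale (normal_coeff f w) (eval_magma mult v w))"
    by (simp add: normal_coeff_def scale_sum_left)
  finally show ?thesis .
qed

section \<open>Independence of the path sums of normal words\<close>

text \<open>Unfolding the recursion gives a signed sum over the leaves of \<open>w\<close>: a leaf labelled \<open>x\<close>
  contributes \<open>\<sigma> x\<close> times the product of \<open>\<rho> u\<close> over the subwords \<open>u\<close> that hang off the path from
  the root to this leaf.\<close>

primrec path_sum :: "nat magma \<Rightarrow> (nat \<Rightarrow> 'k::field) \<Rightarrow> (nat magma \<Rightarrow> 'k) \<Rightarrow> 'k" where
  "path_sum (Var x) \<sigma> \<rho> = \<sigma> x"
| "path_sum (Mul s t) \<sigma> \<rho> = path_sum s \<sigma> \<rho> * \<rho> t - path_sum t \<sigma> \<rho> * \<rho> s"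

text \<open>Only proper subwords of \<open>w\<close> occur as arguments of \<open>\<rho>\<close>, and their codes are smaller.\<close>

lemma path_sum_fun_upd: "word_code w \<le> word_code a \<Longrightarrow> path_sum w \<sigma> (\<rho>(a := r)) = path_sum w \<sigma> \<rho>"
proof (induction w)
  case (Mul s t)
  then show ?case using code_factor_less[of s t] code_factor_less[of t s] by auto
qed simp

text \<open>The path sum has degree at most one in \<open>\<rho> a\<close> here, so the difference of its values at 0 and
  at 1 extracts minus the coefficient of \<open>\<rho> a\<close>. If \<open>a\<close> is not smaller than the left factor \<open>s\<close>, it
  is larger than every other proper subword, which leaves \<open>\<rho> s\<close> with \<open>s = a\<close> as the only
  occurrence.\<close>

lemma path_sum_normal_upd_diff:
  assumes "normal (Mul s t)" "word_code s \<le> word_code a"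
  shows "path_sum (Mul s t) \<sigma> (\<rho>(a := 0)) - path_sum (Mul s t) \<sigma> (\<rho>(a := 1)) =
    (if s = a then path_sum t \<sigma> \<rho> else 0)"
  using assms by (auto simp: path_sum_fun_upd)

text \<open>By induction on a bound \<open>n\<close> for the codes. Putting \<open>\<rho> = 0\<close> kills all products and isolates
  the letters. For the products, the coefficient of \<open>\<rho> a\<close> for the largest relevant left factor
  \<open>a\<close> yields a relation between the right factors of \<open>a\<close>, whose codes are below a smaller bound.\<close>

lemma path_sum_independent:
  assumes "finite W" "\<forall>w\<in>W. normal w"
    and "\<And>\<sigma> \<rho>. (\<Sum>w\<in>W. g w * path_sum w \<sigma> \<rho>) = (0::'k::field)"
    and "w \<in> W"
  shows "g w = 0"
proof -
  have "\<forall>w\<in>W. g w = 0"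
    if "finite W" "\<forall>w\<in>W. normal w \<and> word_code w < n"
      "\<And>\<sigma> \<rho>. (\<Sum>w\<in>W. g w * path_sum w \<sigma> \<rho>) = 0" for n W and g :: "nat magma \<Rightarrow> 'k"
    using that
  proof (induction n arbitrary: W g)
    case 0
    then show ?case by auto
  next
    case (Suc n)
    have letter: "g (Var x) = 0" if "Var x \<in> W" for x
    proof -
      have "g w * path_sum w (\<lambda>y. if y = x then 1 else 0) (\<lambda>_. 0) =
          (if w = Var x then g (Var x) else 0)" for w
        by (cases w) auto
      then show ?thesis
        using Suc.prems(1) Suc.prems(3)[of "\<lambda>y. if y = x then 1 else 0" "\<lambda>_. 0"] that
        by (simp add: sum.delta)
    qed
    have product: "g (Mul s t) = 0" if st: "Mul s t \<in> W" for s t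
    proof (rule ccontr)
      assume nz: "g (Mul s t) \<noteq> 0"
      \<comment> \<open>the left factors that occur with a nonzero coefficient\<close>
      define L where "L = {a. \<exists>b. Mul a b \<in> W \<and> g (Mul a b) \<noteq> 0}"
      have "L \<subseteq> (\<lambda>w. case w of Mul a b \<Rightarrow> a | Var x \<Rightarrow> Var x) ` W"
        by (force simp: L_def)
      then have finL: "finite L"
        using Suc.prems(1) finite_subset by blast
      have "s \<in> L"
        using st nz by (auto simp: L_def)
      then have "Max (word_code ` L) \<in> word_code ` L"
        using finL by (intro Max_in) auto
      then obtain a where "a \<in> L" "word_code a = Max (word_code ` L)"
        by auto
      then have a: "a \<in> L" "\<And>c. c \<in> L \<Longrightarrow> word_code c \<le> word_code a"
        using finL by auto
      define B where "B = {b. Mul a b \<in> W}"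
      have inj: "inj_on (Mul a) B"
        by (auto simp: inj_on_def)
      have sub: "Mul a ` B \<subseteq> W"
        by (auto simp: B_def)
      have finB: "finite B"
        using inj sub Suc.prems(1) by (metis finite_imageD finite_subset)
      have "(\<Sum>b\<in>B. g (Mul a b) * path_sum b \<sigma> \<rho>) = 0" for \<sigma> \<rho>
      proof -
        \<comment> \<open>the contribution of \<open>w\<close> to the coefficient of \<open>\<rho> a\<close>, up to sign\<close>
        let ?d = "\<lambda>w. g w * (path_sum w \<sigma> (\<rho>(a := 0)) - path_sum w \<sigma> (\<rho>(a := 1)))"
        have d: "?d w = (if w \<in> Mul a ` B then ?d w else 0)" if "w \<in> W" for w
        proof (cases w)
          case (Mul c b)
          have "g w = 0 \<or> c = a \<or> word_code c \<le> word_code a \<and> c \<noteq> a"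
            using a(2)[of c] that Mul by (auto simp: L_def)
          moreover have "normal (Mul c b)"
            using Suc.prems(2) that Mul by blast
          ultimately show ?thesis
            using that Mul path_sum_normal_upd_diff[of c b a \<sigma> \<rho>] by (auto simp: B_def simp del: path_sum.simps)
        qed simp
        have e: "?d (Mul a b) = g (Mul a b) * path_sum b \<sigma> \<rho>" if "b \<in> B" for b
        proof -
          have "normal (Mul a b)"
            using Suc.prems(2) that by (auto simp: B_def)
          then show ?thesis
            using path_sum_normal_upd_diff[of a b a \<sigma> \<rho>] by simp
        qed
        have "(\<Sum>b\<in>B. g (Mul a b) * path_sum b \<sigma> \<rho>) = (\<Sum>w\<in>Mul a ` B. ?d w)"
          unfolding sum.reindex[OF inj] o_def by (rule sum.cong[OF refl]) (rule e[symmetric])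
        also have "\<dots> = (\<Sum>w\<in>W. ?d w)"
          using d by (intro sum.mono_neutral_left[OF Suc.prems(1) sub]) (metis DiffE)
        also have "\<dots> = 0"
          by (simp add: right_diff_distrib sum_subtractf Suc.prems(3))
        finally show ?thesis .
      qed
      moreover have "\<forall>b\<in>B. normal b \<and> word_code b < n"
      proof
        fix b assume "b \<in> B"
        then have "normal (Mul a b)" "word_code (Mul a b) < Suc n"
          using Suc.prems(2) by (auto simp: B_def simp del: word_code.simps)
        then show "normal b \<and> word_code b < n"
          using code_factor_less(2)[of b a] by auto
      qed
      ultimately have "\<forall>b\<in>B. g (Mul a b) = 0"
        by (intro Suc.IH[OF finB])
      then show False
        using a(1) by (auto simp: L_def B_def)
    qed
    show ?case
    proof
      fix w assume "w \<in> W"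
      then show "g w = 0" using letter product by (cases w) auto
    qed
  qed
  from this[of W "Suc (Max (word_code ` W))" g] assms show ?thesis
    by (simp add: less_Suc_eq_le)
qed

section \<open>A NAP algebra separating normal words\<close>

definition fun_scale :: "'k::field \<Rightarrow> ('s \<Rightarrow> 'r \<Rightarrow> 'k) \<Rightarrow> 's \<Rightarrow> 'r \<Rightarrow> 'k" where
  "fun_scale r p = (\<lambda>\<sigma> \<rho>. r * p \<sigma> \<rho>)"

interpretation fun_space: vector_space fun_scale
  by unfold_locales (auto simp: fun_scale_def fun_eq_iff algebra_simps)

lemma sum_fun_apply2: "sum F A x y = (\<Sum>i\<in>A. F i x y)"
  by (induction A rule: infinite_finite_induct) simp_all

lemma inj_on_path_sum: "inj_on (path_sum :: _ \<Rightarrow> (nat \<Rightarrow> 'k::field) \<Rightarrow> _) {w. normal w}"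
proof (rule inj_onI, rule ccontr)
  fix u w
  assume *: "u \<in> {w. normal w}" "w \<in> {w. normal w}"
    "(path_sum u :: (nat \<Rightarrow> 'k) \<Rightarrow> _) = path_sum w" "u \<noteq> w"
  have "(\<Sum>z\<in>{u, w}. (if z = u then 1 else - 1) * path_sum z \<sigma> \<rho>) = (0::'k)" for \<sigma> \<rho>
    using * by simp
  then have "(if u = u then 1 else - 1) = (0::'k)"
    using * by (intro path_sum_independent[of "{u, w}" "\<lambda>z. if z = u then 1 else - 1" u]) auto
  then show False by simp
qed

lemma independent_path_sum:
  "fun_space.independent ((path_sum :: _ \<Rightarrow> (nat \<Rightarrow> 'k::field) \<Rightarrow> _) ` {w. normal w})"
proof
  assume "fun_space.dependent ((path_sum :: _ \<Rightarrow> (nat \<Rightarrow> 'k) \<Rightarrow> _) ` {w. normal w})"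
  then obtain T and c :: "((nat \<Rightarrow> 'k) \<Rightarrow> (nat magma \<Rightarrow> 'k) \<Rightarrow> 'k) \<Rightarrow> 'k" and p
    where T: "finite T" "T \<subseteq> path_sum ` {w. normal w}"
      "(\<Sum>p\<in>T. fun_scale (c p) p) = 0" "p \<in> T" "c p \<noteq> 0"
    unfolding fun_space.dependent_explicit by auto
  obtain W where W: "W \<subseteq> {w. normal w}" "finite W" "T = path_sum ` W"
    using finite_subset_image[OF T(1,2)] by auto
  have inj: "inj_on (path_sum :: _ \<Rightarrow> (nat \<Rightarrow> 'k) \<Rightarrow> _) W"
    by (rule inj_on_subset[OF inj_on_path_sum W(1)])
  have zero: "(\<Sum>w\<in>W. c (path_sum w) * path_sum w \<sigma> \<rho>) = 0" for \<sigma> \<rho>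
  proof -
    have "(\<Sum>p\<in>T. fun_scale (c p) p) \<sigma> \<rho> = 0"
      unfolding T(3) by simp
    then show ?thesis
      unfolding W(3) sum.reindex[OF inj] by (simp add: fun_scale_def sum_fun_apply2)
  qed
  obtain w where w: "w \<in> W" "p = path_sum w"
    using T(4) W(3) by auto
  have "c (path_sum w) = 0"
    by (rule path_sum_independent[OF W(2) _ zero w(1)]) (use W(1) in auto)
  then show False
    using T(5) w(2) by simp
qed

lemma fun_scale_pair: "vector_space_pair
    (fun_scale :: 'k::field \<Rightarrow> ('s \<Rightarrow> 'r \<Rightarrow> 'k) \<Rightarrow> _)
    (fun_scale :: 'k \<Rightarrow> ('s \<Rightarrow> 'r \<Rightarrow> 'k) \<Rightarrow> _)" ..

text \<open>The map \<open>\<phi>\<close> that defines the NAP product: its values on the path sums may be prescribed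
  because these are independent.\<close>

lemma path_sum_representation:
  obtains \<phi> :: "((nat \<Rightarrow> 'k::field) \<Rightarrow> (nat magma \<Rightarrow> 'k) \<Rightarrow> 'k) \<Rightarrow> (nat \<Rightarrow> 'k) \<Rightarrow> (nat magma \<Rightarrow> 'k) \<Rightarrow> 'k"
  where "Vector_Spaces.linear fun_scale fun_scale \<phi>"
    and "\<And>w. normal w \<Longrightarrow> \<phi> (path_sum w) = (\<lambda>\<sigma> \<rho>. \<rho> w)"
proof -
  let ?N = "{w. normal w}"
  obtain \<phi> :: "((nat \<Rightarrow> 'k) \<Rightarrow> (nat magma \<Rightarrow> 'k) \<Rightarrow> 'k) \<Rightarrow> (nat \<Rightarrow> 'k) \<Rightarrow> (nat magma \<Rightarrow> 'k) \<Rightarrow> 'k"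
    where lin: "Vector_Spaces.linear fun_scale fun_scale \<phi>"
      and ext: "\<forall>p\<in>path_sum ` ?N. \<phi> p = (\<lambda>\<sigma> \<rho>. \<rho> (inv_into ?N path_sum p))"
    using vector_space_pair.linear_independent_extend[OF fun_scale_pair independent_path_sum,
        of "\<lambda>p \<sigma> \<rho>. \<rho> (inv_into ?N path_sum p)"]
    by (elim exE conjE) (rule that)
  have "\<phi> (path_sum w) = (\<lambda>\<sigma> \<rho>. \<rho> w)" if "normal w" for w
    using ext inv_into_f_f[OF inj_on_path_sum[where 'k = 'k], of w] that by simp
  with lin show ?thesis
    by (rule that)
qed

section \<open>Identities of the commutator algebra\<close>

text \<open>The assignment \<open>v\<close> extends to a homomorphism from the free NAP algebra, which is also a
  homomorphism for the commutators.\<close>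

lemma nap_identity_transfer:
  fixes scale :: "'k::field \<Rightarrow> 'a::ab_group_add \<Rightarrow> 'a"
  assumes "nap_algebra scale mult"
    and f: "is_identity (nap_scale :: 'k \<Rightarrow> (nat, 'k) nap \<Rightarrow> _) (commutator nap_mult) f"
  shows "is_identity scale (commutator mult) f"
  unfolding is_identity_def
proof
  fix v :: "nat \<Rightarrow> 'a"
  interpret nap_algebra scale mult by fact
  obtain h :: "(nat, 'k) nap \<Rightarrow> 'a" where h_add: "\<And>a b. h (a + b) = h a + h b"
    and h_scale: "\<And>r a. h (nap_scale r a) = scale r (h a)"
    and h_mult: "\<And>a b. h (nap_mult a b) = mult (h a) (h b)"
    and h_var: "\<And>x. h (nap_var x) = v x"
    using nap_universal[OF assms(1), of v] by blast
  have h0: "h 0 = 0"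
    using h_add[of 0 0] by simp
  have h_diff: "h (a - b) = h a - h b" for a b
    using h_add[of "a - b" b] by simp
  have h_sum: "h (sum F A) = (\<Sum>i\<in>A. h (F i))" for F and A :: "nat magma set"
    by (induction A rule: infinite_finite_induct) (simp_all add: h0 h_add)
  have h_eval: "h (eval_magma (commutator nap_mult) nap_var t) = eval_magma (commutator mult) v t" for t
    by (induction t) (simp_all add: h_var h_diff h_mult commutator_def)
  have "eval_npoly scale (commutator mult) v f =
      h (eval_npoly nap_scale (commutator nap_mult) nap_var f)"
    by (simp add: eval_npoly_def h_sum h_scale h_eval)
  also have "\<dots> = 0"
    using f by (simp add: is_identity_def h0)
  finally show "eval_npoly scale (commutator mult) v f = 0" .
qed

text \<open>In the algebra with product \<open>p \<phi>(q)\<close> the commutator of the path sums of \<open>s\<close> and \<open>t\<close> is the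
  path sum of \<open>s t\<close>, whenever \<open>s\<close> and \<open>t\<close> are normal. So an identity evaluates there to a linear
  relation between path sums of normal words.\<close>

lemma normal_coeff_eq_0:
  fixes f :: "(nat, 'k::field_char_0) npoly"
  assumes "is_identity (nap_scale :: 'k \<Rightarrow> (nat, 'k) nap \<Rightarrow> _) (commutator nap_mult) f"
    and w: "w \<in> normal_form ` Poly_Mapping.keys f"
  shows "normal_coeff f w = 0"
proof -
  obtain \<phi> :: "((nat \<Rightarrow> 'k) \<Rightarrow> (nat magma \<Rightarrow> 'k) \<Rightarrow> 'k) \<Rightarrow> (nat \<Rightarrow> 'k) \<Rightarrow> (nat magma \<Rightarrow> 'k) \<Rightarrow> 'k"
    where lin: "Vector_Spaces.linear fun_scale fun_scale \<phi>"
      and \<phi>: "\<And>w. normal w \<Longrightarrow> \<phi> (path_sum w) = (\<lambda>\<sigma> \<rho>. \<rho> w)"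
    using path_sum_representation by blast
  interpret \<phi>: Vector_Spaces.linear fun_scale fun_scale \<phi> by (fact lin)
  define m where "m p q = (\<lambda>\<sigma> \<rho>. p \<sigma> \<rho> * \<phi> q \<sigma> \<rho>)" for p q
  interpret A: nap_algebra fun_scale m
    by unfold_locales
      (simp_all add: m_def \<phi>.add \<phi>.scale, simp_all add: fun_scale_def fun_eq_iff algebra_simps)
  interpret C: nonassoc_algebra fun_scale "commutator m"
    by (rule A.commutator_algebra)
  interpret C: anticommutative_algebra fun_scale "commutator m"
    by unfold_locales (simp add: commutator_def)
  let ?v = "\<lambda>x \<sigma> \<rho>. \<sigma> x"
  have eval: "eval_magma (commutator m) ?v w = path_sum w" if "normal w" for w
    using that
  proof (induction w)
    case (Mul s t)
    then have "eval_magma (commutator m) ?v (Mul s t) = commutator m (path_sum s) (path_sum t)"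
      by simp
    also have "\<dots> = path_sum (Mul s t)"
      using Mul.prems by (simp add: commutator_def m_def \<phi> fun_eq_iff)
    finally show ?case .
  qed (simp add: fun_eq_iff)
  let ?W = "normal_form ` Poly_Mapping.keys f"
  have W: "\<forall>w\<in>?W. normal w"
    by (auto simp: normal_normal_form)
  have "is_identity fun_scale (commutator m) f"
    by (rule nap_identity_transfer[OF A.nap_algebra_axioms assms(1)])
  then have "(\<Sum>w\<in>?W. fun_scale (normal_coeff f w) (eval_magma (commutator m) ?v w)) = 0"
    unfolding is_identity_def C.eval_npoly_normal_coeff by blast
  then have zero: "(\<Sum>w\<in>?W. fun_scale (normal_coeff f w) (path_sum w)) = 0"
    using W by (simp add: eval cong: sum.cong)
  have "(\<Sum>w\<in>?W. normal_coeff f w * path_sum w \<sigma> \<rho>) = 0" for \<sigma> \<rho>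
    using fun_cong[OF fun_cong[OF zero, of \<sigma>], of \<rho>] by (simp add: fun_scale_def sum_fun_apply2)
  then show ?thesis
    using path_sum_independent[of ?W "normal_coeff f"] W w by simp
qed

theorem theorem10:
  fixes f :: "(nat, 'k::field_char_0) npoly"
  assumes "is_identity (nap_scale :: 'k \<Rightarrow> (nat, 'k) nap \<Rightarrow> (nat, 'k) nap) (commutator nap_mult) f"
  shows "is_consequence TYPE('a::ab_group_add) {anticomm_identity} f"
  unfolding is_consequence_def
proof (intro allI impI)
  fix scale :: "'k \<Rightarrow> 'a \<Rightarrow> 'a" and mult
  assume alg: "nonassoc_algebra scale mult"
    and "\<forall>q\<in>{anticomm_identity}. is_identity scale mult q"
  then have anti: "mult a b = - mult b a" for a b
    using nonassoc_algebra.is_identity_anticomm[OF alg] by blast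
  interpret anticommutative_algebra scale mult
    by (intro anticommutative_algebra.intro anticommutative_algebra_axioms.intro alg anti)
  show "is_identity scale mult f"
    unfolding is_identity_def eval_npoly_normal_coeff
    using normal_coeff_eq_0[OF assms] by (intro allI sum.neutral ballI) simp
qed

end
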